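(* Let $\mathcal{T}_h$ be a three-dimensional triangulation without hanging nodes, with shape regularity constant $c_0=\max_{T\in\mathcal{T}_h} h_T/\rho_T$, and for each face $F$ of $\mathcal{T}_h$ let $m_F$ be the split point of $F$ in the Worsey-Farin refinement of $\mathcal{T}_h$. Then for any face $F$ of $\mathcal{T}_h$, $$\operatorname{dist}(m_F,\partial F)\ \ge\ c_2\ \min_{\substack{T\in\mathcal{T}_h\\ F\in\Delta_2(T)}} h_T,$$ where $$c_2:=\min\{\mathfrak{c}_2,\,(3c_0)^{-1}\},\qquad \mathfrak{c}_2:=(2c_0)^{-1}\sqrt{-1+\frac{2}{1+\sqrt{1-c_0^{-2}}}}.$$
   Context: $\mathcal{T}_h$ is a finite set of nondegenerate closed tetrahedra in $\mathbb{R}^3$ without hanging nodes (any two distinct tetrahedra intersect in the empty set, a common vertex, a common edge or a common face); $\Omega$ denotes the domain it triangulates. For a tetrahedron $T$, $\Delta_2(T)$ is the set of its four faces, $h_T=\operatorname{diam}(T)$, $\rho_T$ is the diameter of the inscribed sphere of $T$ (the largest sphere contained in $T$), and the incenter $z_T$ is the center of that sphere. Split points of the Worsey-Farin refinement: for an interior face $F=T_1\cap T_2$ with $T_1,T_2\in\mathcal{T}_h$, $m_F$ is the intersection of $F$ with the line segment $[z_{T_1},z_{T_2}]$ joining the incenters (it is known that this segment intersects the common face, so $m_F$ is well defined); for a boundary face $F$ (a face contained in $\partial\Omega$, belonging to exactly one $T\in\mathcal{T}_h$), $m_F$ is the barycenter of $F$. Here $\partial F$ is the boundary of the triangle $F$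 relative to its plane, i.e. the union of its three edges, and $\operatorname{dist}$ is Euclidean distance. *)

theory Defs
  imports "HOL-Analysis.Analysis"
begin

text \<open>Conformity is the library's \<^const>\<open>triangulation\<close>: any two members meet in a face
  (possibly empty) of both.\<close>

definition tetrahedral_mesh :: "(real^3) set set \<Rightarrow> bool" where
  "tetrahedral_mesh \<T> \<longleftrightarrow> triangulation \<T> \<and> (\<forall>T\<in>\<T>. 3 simplex T)"

definition mesh_faces :: "(real^3) set set \<Rightarrow> (real^3) set set" where
  "mesh_faces \<T> = {F. \<exists>T\<in>\<T>. F facet_of T}"

definition inradius :: "(real^3) set \<Rightarrow> real" where
  "inradius T = Sup {r. 0 \<le> r \<and> (\<exists>z. sphere z r \<subseteq> T)}"

text \<open>The inscribed sphere of a tetrahedron is unique.\<close>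

definition incenter :: "(real^3) set \<Rightarrow> real^3" where
  "incenter T = (THE z. sphere z (inradius T) \<subseteq> T)"

definition insphere_diameter :: "(real^3) set \<Rightarrow> real" where
  "insphere_diameter T = 2 * inradius T"

definition shape_regularity :: "(real^3) set set \<Rightarrow> real" where
  "shape_regularity \<T> = Max ((\<lambda>T. diameter T / insphere_diameter T) ` \<T>)"

definition barycenter :: "(real^3) set \<Rightarrow> real^3" where
  "barycenter F =
     (1 / real (card {v. v extreme_point_of F})) *\<^sub>R (\<Sum>v | v extreme_point_of F. v)"

text \<open>The closure of the triangulated domain is \<^term>\<open>\<Union>\<T>\<close>; this union of nondegenerate
  tetrahedra is regular closed, so it has the same frontier as the domain.\<close>

definition boundary_face :: "(real^3) set set \<Rightarrow> (real^3) set \<Rightarrow> bool" where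
  "boundary_face \<T> F \<longleftrightarrow> F \<subseteq> frontier (\<Union>\<T>) \<and> (\<exists>!T. T \<in> \<T> \<and> F facet_of T)"

text \<open>A face that is not a boundary face is the intersection of exactly two tetrahedra of the
  mesh, and the description in the second branch then determines a single point.\<close>

definition split_point :: "(real^3) set set \<Rightarrow> (real^3) set \<Rightarrow> real^3" where
  "split_point \<T> F =
     (if boundary_face \<T> F then barycenter F
      else (THE m. \<exists>T1\<in>\<T>. \<exists>T2\<in>\<T>. T1 \<noteq> T2 \<and> F = T1 \<inter> T2 \<and>
                     F \<inter> closed_segment (incenter T1) (incenter T2) = {m}))"

definition frak_c2 :: "real \<Rightarrow> real" where
  "frak_c2 c0 = inverse (2 * c0) * sqrt (-1 + 2 / (1 + sqrt (1 - inverse (c0\<^sup>2))))"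

definition const_c2 :: "real \<Rightarrow> real" where
  "const_c2 c0 = min (frak_c2 c0) (inverse (3 * c0))"

end

theory Submission
  imports Defs
begin

text \<open>Let \<open>F\<close> be a face of a tetrahedron \<open>T\<close> with incenter \<open>z\<close>, inradius \<open>r\<close> and diameter \<open>h\<close>, and
  let \<open>e\<close> be an edge of \<open>F\<close>.  Take orthonormal vectors \<open>n\<close>, normal to \<open>F\<close>, and \<open>u\<close>, in the plane of
  \<open>F\<close> and normal to \<open>e\<close>.  Distances from the line of \<open>e\<close> within \<open>F\<close> are values of the affine
  function \<open>u \<bullet> x - g\<close> that vanishes on \<open>e\<close>, so it is enough to bound this function from below at the
  split point, for each of the three edges.

  If two tetrahedra share \<open>F\<close>, the incenters lie on opposite sides of \<open>F\<close>, and the split point is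
  a convex combination of them.  The function is affine, so it suffices to bound it at each
  incenter.  Write the apex of \<open>T\<close> relative to \<open>e\<close> as \<open>s u + H n\<close> with \<open>s\<^sup>2 + H\<^sup>2 = L\<^sup>2\<close>.  The inner
  normal of the other face through \<open>e\<close> is then \<open>(H u - s n) / L\<close>, and tangency of the inscribed
  sphere to both faces gives \<open>u \<bullet> z - g = r (L + s) / H\<close>, which is \<open>r cot (\<theta>/2)\<close> for the dihedral
  angle \<open>\<theta>\<close> at \<open>e\<close> (\<open>incenter_ridge_distance\<close>).  The ball has to fit below the apex, whence
  \<open>2 r \<le> H\<close>, and \<open>L \<le> h\<close>; hence \<open>sin \<theta> = H / L \<ge> 2 r / h \<ge> 1 / c\<^sub>0\<close>.  So \<open>\<theta>\<close> cannot come too close to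
  \<open>\<pi>\<close>, and \<open>cot (\<theta>/2)\<close> is at least \<open>tan (\<alpha>/2)\<close> where \<open>0 < \<alpha> \<le> \<pi>/2\<close> and
  \<open>sin \<alpha> = 1 / c\<^sub>0\<close>.  Since \<open>r \<ge> h / (2 c\<^sub>0)\<close>, this is the bound with the first constant
  (\<open>frak_c2_lower_bound\<close>).

  On a boundary face the split point is the barycenter, whose distance from \<open>e\<close> is a third of the
  corresponding height of the triangle \<open>F\<close>.  That height is at least the height of \<open>T\<close> over the
  other face through \<open>e\<close>, hence at least \<open>2 r \<ge> h / c\<^sub>0\<close>; this is the second constant.

  Tangency of the largest sphere to all faces is proved with barycentric coordinates
  (\<open>inscribed_sphere\<close>): a sphere of radius \<open>\<rho>\<close> inside \<open>T\<close> needs its center at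
  height \<open>\<ge> \<rho>\<close> over every face, and the barycentric coordinates of the center, which are these
  heights divided by those of \<open>T\<close>, have sum \<open>1\<close>.  The other ingredient is the combinatorics of
  conforming meshes: a face that belongs to just one tetrahedron lies on the frontier
  (\<open>unique_facet_imp_boundary_face\<close>), and two tetrahedra sharing a face lie on opposite sides of it
  (\<open>apexes_on_opposite_sides\<close>), so that no face has three neighbours and the split point is well
  defined.\<close>

section \<open>Heights over the facets of a simplex\<close>

text \<open>The hyperplane \<open>n \<bullet> x = b\<close> carries the facet of the simplex with vertex set \<open>c\<close> opposite to
  \<open>v\<close>, and \<open>n\<close> points towards \<open>v\<close>; so \<open>n \<bullet> x - b\<close> is the signed height of \<open>x\<close> over that facet.\<close>

definition inner_unit_normal :: "'a::euclidean_space set \<Rightarrow> 'a \<Rightarrow> 'a \<Rightarrow> real \<Rightarrow> bool" where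
  "inner_unit_normal c v n b \<longleftrightarrow> norm n = 1 \<and> (\<forall>w\<in>c - {v}. n \<bullet> w = b) \<and> b < n \<bullet> v"

lemma inner_unit_normal_exists:
  fixes c :: "'a::euclidean_space set"
  assumes ind: "\<not> affine_dependent c" and card: "card c = Suc DIM('a)" and v: "v \<in> c"
  shows "\<exists>n b. inner_unit_normal c v n b"
proof -
  have fin: "finite c" using ind aff_independent_finite by blast
  have ind': "\<not> affine_dependent (c - {v})" using ind affine_independent_Diff by blast
  have "aff_dim (c - {v}) = DIM('a) - 1"
    using aff_dim_affine_independent[OF ind'] card v fin by simp
  then obtain a d where a: "a \<noteq> 0" and hull: "affine hull (c - {v}) = {x. a \<bullet> x = d}"
    using aff_dim_eq_hyperplane by blast
  have "v \<notin> affine hull (c - {v})" using ind v by (auto simp: affine_dependent_def)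
  then have ne: "a \<bullet> v \<noteq> d" using hull by auto
  define s where "s = sgn (a \<bullet> v - d) / norm a"
  have "norm (s *\<^sub>R a) = 1" using a ne by (simp add: s_def abs_sgn_eq)
  moreover have "\<forall>w\<in>c - {v}. (s *\<^sub>R a) \<bullet> w = s * d"
    using hull_subset[of "c - {v}" affine] hull by auto
  moreover have "s * d < (s *\<^sub>R a) \<bullet> v"
  proof -
    have "0 < s * (a \<bullet> v - d)" using a ne
      by (simp add: s_def sgn_if divide_neg_pos mult_pos_pos divide_simps)
    then show ?thesis by (simp add: algebra_simps)
  qed
  ultimately show ?thesis unfolding inner_unit_normal_def by blast
qed

text \<open>The height over a facet is the barycentric coordinate of the opposite vertex, scaled by the
  height of that vertex: the height is affine and vanishes at all the other vertices.\<close>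

lemma inner_unit_normal_affine_combination:
  assumes "inner_unit_normal c v n b" "finite c" "v \<in> c" "sum u c = 1"
  shows "n \<bullet> (\<Sum>w\<in>c. u w *\<^sub>R w) - b = u v * (n \<bullet> v - b)"
proof -
  have "n \<bullet> (\<Sum>w\<in>c. u w *\<^sub>R w) - b = (\<Sum>w\<in>c. u w * (n \<bullet> w - b))"
    using assms(4) by (simp add: inner_sum_right right_diff_distrib sum_subtractf flip: sum_distrib_right)
  also have "\<dots> = (\<Sum>w\<in>c. if w = v then u v * (n \<bullet> v - b) else 0)"
    using assms(1) by (intro sum.cong) (auto simp: inner_unit_normal_def)
  finally show ?thesis using assms(2,3) by simp
qed

lemma inner_unit_normal_bounds:
  assumes "inner_unit_normal c v n b" "v \<in> c" "x \<in> convex hull c"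
  shows "b \<le> n \<bullet> x" "n \<bullet> x \<le> n \<bullet> v"
proof -
  have "c \<subseteq> {y. n \<bullet> y \<ge> b} \<inter> {y. n \<bullet> y \<le> n \<bullet> v}"
  proof
    fix y assume "y \<in> c"
    then show "y \<in> {y. n \<bullet> y \<ge> b} \<inter> {y. n \<bullet> y \<le> n \<bullet> v}"
      using assms(1) by (cases "y = v") (auto simp: inner_unit_normal_def)
  qed
  moreover have "convex ({y. n \<bullet> y \<ge> b} \<inter> {y. n \<bullet> y \<le> n \<bullet> v})"
    by (intro convex_Int convex_halfspace_ge convex_halfspace_le)
  ultimately have "convex hull c \<subseteq> {y. n \<bullet> y \<ge> b} \<inter> {y. n \<bullet> y \<le> n \<bullet> v}"
    by (rule hull_minimal)
  then show "b \<le> n \<bullet> x" "n \<bullet> x \<le> n \<bullet> v" using assms(3) by auto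
qed

text \<open>Both height functions are positive multiples of the same barycentric coordinate; unit length
  of the normals makes the factors agree.  Hence tangency, once known for a chosen system of
  normals, holds for any normal that is found later by other means.\<close>

lemma inner_unit_normal_unique:
  fixes c :: "'a::euclidean_space set"
  assumes ind: "\<not> affine_dependent c" and card: "card c = Suc DIM('a)" and v: "v \<in> c"
    and nb: "inner_unit_normal c v n b" and nb': "inner_unit_normal c v n' b'"
  shows "n \<bullet> x - b = n' \<bullet> x - b'"
proof -
  have fin: "finite c" using ind aff_independent_finite by blast
  define H where "H = n \<bullet> v - b"
  define H' where "H' = n' \<bullet> v - b'"
  have H: "H > 0" "H' > 0" using nb nb' by (auto simp: H_def H'_def inner_unit_normal_def)
  have scaled: "H' * (n \<bullet> y - b) = H * (n' \<bullet> y - b')" for y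
  proof -
    have "y \<in> affine hull c" using affine_independent_span_eq[OF ind card] by simp
    then obtain u where u: "sum u c = 1" "y = (\<Sum>w\<in>c. u w *\<^sub>R w)"
      using affine_hull_finite[OF fin] by auto
    show ?thesis
      using inner_unit_normal_affine_combination[OF nb fin v u(1)]
        inner_unit_normal_affine_combination[OF nb' fin v u(1)] u(2)
      by (simp add: H_def H'_def)
  qed
  have lin: "(H' *\<^sub>R n) \<bullet> y = (H *\<^sub>R n') \<bullet> y" for y
    using scaled[of y] scaled[of 0] by (simp add: algebra_simps)
  have "H' *\<^sub>R n = H *\<^sub>R n'" by (rule vector_eq_ldot[THEN iffD1]) (use lin in \<open>auto simp: inner_commute\<close>)
  then have "norm (H' *\<^sub>R n) = norm (H *\<^sub>R n')" by simp
  then have "H' = H" using H nb nb' by (simp add: inner_unit_normal_def)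
  then show ?thesis using scaled[of x] H by simp
qed

lemma mem_facet_if_in_hyperplane:
  assumes n: "inner_unit_normal (insert a V) a n b" and V: "finite V" "a \<notin> V"
    and x: "x \<in> convex hull (insert a V)" "n \<bullet> x = b"
  shows "x \<in> convex hull V"
proof -
  obtain u where u: "\<forall>w\<in>insert a V. 0 \<le> u w" "sum u (insert a V) = 1" "(\<Sum>w\<in>insert a V. u w *\<^sub>R w) = x"
    using x(1) V by (auto simp: convex_hull_finite)
  have "u a * (n \<bullet> a - b) = 0"
    using inner_unit_normal_affine_combination[OF n _ _ u(2)] V u(3) x(2) by simp
  then have "u a = 0" using n by (simp add: inner_unit_normal_def)
  then have "sum u V = 1" "(\<Sum>w\<in>V. u w *\<^sub>R w) = x" using u V by auto
  then show ?thesis using u(1) V by (auto simp: convex_hull_finite)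
qed

section \<open>The inscribed sphere\<close>

text \<open>If \<open>H v\<close> is the height of the simplex over the facet opposite \<open>v\<close>, a sphere of radius \<open>r'\<close>
  inside the simplex has a center with barycentric coordinates \<open>\<ge> r' / H v\<close>.  Summing,
  \<open>r' * (\<Sum>v\<in>c. inverse (H v)) \<le> 1\<close>, with equality only if all the coordinates equal \<open>r' / H v\<close>; and
  the point with these coordinates is at distance \<open>r'\<close> from all facets.\<close>

lemma inscribed_sphere:
  fixes c :: "'a::euclidean_space set"
  assumes ind: "\<not> affine_dependent c" and card: "card c = Suc DIM('a)"
  obtains z r where "r > 0" "sphere z r \<subseteq> convex hull c"
    and "\<And>v n b. \<lbrakk>v \<in> c; inner_unit_normal c v n b\<rbrakk> \<Longrightarrow> n \<bullet> z = b + r"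
    and "\<And>z' r'. \<lbrakk>r' \<ge> 0; sphere z' r' \<subseteq> convex hull c\<rbrakk> \<Longrightarrow> r' \<le> r \<and> (r' = r \<longrightarrow> z' = z)"
proof -
  have fin: "finite c" using ind aff_independent_finite by blast
  have ne: "c \<noteq> {}" using card by auto
  obtain n b where nb: "\<And>v. v \<in> c \<Longrightarrow> inner_unit_normal c v (n v) (b v)"
    using inner_unit_normal_exists[OF ind card] by metis
  define H where "H v = n v \<bullet> v - b v" for v
  have H: "H v > 0" if "v \<in> c" for v using nb[OF that] by (auto simp: H_def inner_unit_normal_def)
  define r where "r = inverse (\<Sum>v\<in>c. inverse (H v))"
  have S: "(\<Sum>v\<in>c. inverse (H v)) > 0" using H fin ne by (intro sum_pos) auto
  have r: "r > 0" using S by (simp add: r_def)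
  \<comment> \<open>The center has the barycentric coordinates \<open>r / H v\<close>; their sum is \<open>1\<close> by choice of \<open>r\<close>.\<close>
  define z where "z = (\<Sum>v\<in>c. (r / H v) *\<^sub>R v)"
  have one: "(\<Sum>v\<in>c. r / H v) = 1"
    using S by (simp add: divide_inverse r_def flip: sum_distrib_left)
  have z: "n v \<bullet> z = b v + r" if "v \<in> c" for v
    using inner_unit_normal_affine_combination[OF nb[OF that] fin that one] H[OF that]
    by (simp add: z_def H_def)
  have coords: "\<exists>u. sum u c = 1 \<and> x = (\<Sum>w\<in>c. u w *\<^sub>R w) \<and> (\<forall>v\<in>c. n v \<bullet> x - b v = u v * H v)" for x
  proof -
    have "x \<in> affine hull c" using affine_independent_span_eq[OF ind card] by simp
    then obtain u where u: "sum u c = 1" "x = (\<Sum>w\<in>c. u w *\<^sub>R w)"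
      using affine_hull_finite[OF fin] by auto
    then show ?thesis using inner_unit_normal_affine_combination[OF nb fin _ u(1)] by (auto simp: H_def)
  qed
  have mem: "x \<in> convex hull c" if x: "\<And>v. v \<in> c \<Longrightarrow> b v \<le> n v \<bullet> x" for x
  proof -
    obtain u where u: "sum u c = 1" "x = (\<Sum>w\<in>c. u w *\<^sub>R w)" "\<forall>v\<in>c. n v \<bullet> x - b v = u v * H v"
      using coords by blast
    have "0 \<le> u v" if "v \<in> c" for v
      using x[OF that] u(3) H[OF that] that by (metis diff_ge_0_iff_ge zero_le_mult_iff not_less)
    then show ?thesis using u(1,2) by (auto simp: convex_hull_finite[OF fin])
  qed
  have sph: "sphere z r \<subseteq> convex hull c"
  proof
    fix x assume x: "x \<in> sphere z r"
    show "x \<in> convex hull c"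
    proof (rule mem)
      fix v assume v: "v \<in> c"
      have "\<bar>n v \<bullet> (z - x)\<bar> \<le> norm (n v) * norm (z - x)" by (rule Cauchy_Schwarz_ineq2)
      also have "\<dots> = r" using x nb[OF v] by (simp add: inner_unit_normal_def dist_norm)
      finally show "b v \<le> n v \<bullet> x" using z[OF v] by (simp add: inner_diff_right)
    qed
  qed
  have tan: "m \<bullet> z = d + r" if v: "v \<in> c" and m: "inner_unit_normal c v m d" for v m d
    using inner_unit_normal_unique[OF ind card v m nb[OF v], of z] z[OF v] by simp
  have max: "r' \<le> r \<and> (r' = r \<longrightarrow> z' = z)" if r': "r' \<ge> 0" "sphere z' r' \<subseteq> convex hull c" for z' r'
  proof -
    obtain u where u: "sum u c = 1" "z' = (\<Sum>w\<in>c. u w *\<^sub>R w)" "\<forall>v\<in>c. n v \<bullet> z' - b v = u v * H v"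
      using coords by blast
    have ge: "r' / H v \<le> u v" if v: "v \<in> c" for v
    proof -
      have n1: "norm (n v) = 1" using nb[OF v] by (simp add: inner_unit_normal_def)
      \<comment> \<open>The point of the sphere that is lowest over the facet opposite \<open>v\<close>.\<close>
      have "z' - r' *\<^sub>R n v \<in> sphere z' r'" using r' n1 by (simp add: dist_norm)
      then have "b v \<le> n v \<bullet> (z' - r' *\<^sub>R n v)"
        using r'(2) inner_unit_normal_bounds(1)[OF nb[OF v] v] by blast
      then have "r' \<le> n v \<bullet> z' - b v"
        using n1 by (simp add: inner_diff_right dot_square_norm)
      then show ?thesis using u(3) v H[OF v] by (simp add: divide_le_eq)
    qed
    have "r' / r = (\<Sum>v\<in>c. r' / H v)"
      using S by (simp add: r_def divide_inverse flip: sum_distrib_left)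
    also have "\<dots> \<le> sum u c" using ge by (intro sum_mono) auto
    finally have le: "r' \<le> r" using u(1) r by (simp add: divide_le_eq)
    have "z' = z" if eq: "r' = r"
    proof -
      have "u v = r / H v" if v: "v \<in> c" for v
      proof (rule ccontr)
        assume "u v \<noteq> r / H v"
        then have "r / H v < u v" using ge[OF v] eq by simp
        then have "(\<Sum>v\<in>c. r / H v) < sum u c"
          using ge eq v fin by (intro sum_strict_mono_ex1) auto
        then show False using one u(1) by simp
      qed
      then show ?thesis using u(2) by (simp add: z_def)
    qed
    then show ?thesis using le by blast
  qed
  show ?thesis using that r sph tan max by blast
qed

text \<open>Existence and uniqueness of the largest sphere turn \<^const>\<open>inradius\<close> and \<^const>\<open>incenter\<close>, given by a
  supremum and a definite description, into the radius and center of an actual tangent sphere.\<close>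

lemma inscribed_sphere_of_tetrahedron:
  fixes c :: "(real^3) set"
  assumes ind: "\<not> affine_dependent c" and card: "card c = 4"
  defines "T \<equiv> convex hull c"
  shows "inradius T > 0" "sphere (incenter T) (inradius T) \<subseteq> T"
    and "\<lbrakk>v \<in> c; inner_unit_normal c v n b\<rbrakk> \<Longrightarrow> n \<bullet> incenter T = b + inradius T"
proof -
  have card': "card c = Suc DIM(real^3)" using card by simp
  obtain z r where zr: "r > 0" "sphere z r \<subseteq> T"
    "\<And>v n b. \<lbrakk>v \<in> c; inner_unit_normal c v n b\<rbrakk> \<Longrightarrow> n \<bullet> z = b + r"
    "\<And>z' r'. \<lbrakk>r' \<ge> 0; sphere z' r' \<subseteq> T\<rbrakk> \<Longrightarrow> r' \<le> r \<and> (r' = r \<longrightarrow> z' = z)"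
    by (rule inscribed_sphere[OF ind card', folded T_def]) (rule that)
  have in_eq: "inradius T = r" unfolding inradius_def
  proof (rule cSup_eq_maximum)
    show "r \<in> {r. 0 \<le> r \<and> (\<exists>z. sphere z r \<subseteq> T)}" using zr(1,2) less_imp_le by blast
    show "r' \<le> r" if "r' \<in> {r. 0 \<le> r \<and> (\<exists>z. sphere z r \<subseteq> T)}" for r' using that zr(4) by blast
  qed
  have ic_eq: "incenter T = z" unfolding incenter_def in_eq
  proof (rule the_equality)
    show "sphere z r \<subseteq> T" by (rule zr(2))
    show "z' = z" if "sphere z' r \<subseteq> T" for z' using zr(4)[OF _ that] zr(1) by simp
  qed
  show "inradius T > 0" "sphere (incenter T) (inradius T) \<subseteq> T"
    "\<lbrakk>v \<in> c; inner_unit_normal c v n b\<rbrakk> \<Longrightarrow> n \<bullet> incenter T = b + inradius T"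
    unfolding in_eq ic_eq using zr(1-3) by blast+
qed

text \<open>The inscribed ball touches the facet, and its point farthest from the facet is not higher than
  the opposite vertex.\<close>

lemma height_ge_insphere_diameter:
  fixes c :: "(real^3) set"
  assumes ind: "\<not> affine_dependent c" and card: "card c = 4"
    and v: "v \<in> c" and n: "inner_unit_normal c v n b"
  shows "insphere_diameter (convex hull c) \<le> n \<bullet> v - b"
proof -
  let ?z = "incenter (convex hull c)" and ?r = "inradius (convex hull c)"
  note sph = inscribed_sphere_of_tetrahedron[OF ind card]
  have n1: "norm n = 1" using n by (simp add: inner_unit_normal_def)
  have "?z + ?r *\<^sub>R n \<in> sphere ?z ?r" using n1 sph(1) by (simp add: dist_norm)
  then have "n \<bullet> (?z + ?r *\<^sub>R n) \<le> n \<bullet> v"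
    using sph(2) inner_unit_normal_bounds(2)[OF n v] by blast
  then show ?thesis using sph(3)[OF v n] n1
    by (simp add: insphere_diameter_def inner_add_right dot_square_norm)
qed

text \<open>The orthogonal projection of the incenter to a facet lies in that facet, because it belongs to the
  inscribed sphere.\<close>

lemma touching_point_in_facet:
  fixes V :: "(real^3) set"
  assumes ind: "\<not> affine_dependent (insert a V)" and a: "a \<notin> V" and card: "card V = 3"
    and n: "inner_unit_normal (insert a V) a n b"
  defines "T \<equiv> convex hull (insert a V)"
  shows "incenter T - inradius T *\<^sub>R n \<in> convex hull V"
proof (rule mem_facet_if_in_hyperplane[OF n _ a])
  show fin: "finite V" by (rule card_ge_0_finite) (simp add: card)
  have card4: "card (insert a V) = 4" using a card fin by simp
  note sph = inscribed_sphere_of_tetrahedron[OF ind card4, folded T_def]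
  have n1: "norm n = 1" using n by (simp add: inner_unit_normal_def)
  have "incenter T - inradius T *\<^sub>R n \<in> sphere (incenter T) (inradius T)"
    using n1 sph(1) by (simp add: dist_norm)
  then show "incenter T - inradius T *\<^sub>R n \<in> convex hull insert a V"
    using sph(2) by (auto simp: T_def)
  show "n \<bullet> (incenter T - inradius T *\<^sub>R n) = b"
    using sph(3)[OF _ n] n1 by (simp add: inner_diff_right dot_square_norm)
qed

section \<open>Position of the incenter relative to an edge\<close>

text \<open>With \<open>V\<close> the vertex set of a face and \<open>n\<close> its normal, \<open>u\<close> is the unit vector in the plane of
  the face which is normal to the edge opposite \<open>w\<close> and points towards \<open>w\<close>.  No apex occurs here: the
  two tetrahedra that share the face can be compared along the same \<open>u\<close>.\<close>

definition ridge_normal :: "'a::euclidean_space set \<Rightarrow> 'a \<Rightarrow> 'a \<Rightarrow> 'a \<Rightarrow> real \<Rightarrow> bool" where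
  "ridge_normal V w n u g \<longleftrightarrow> inner_unit_normal V w u g \<and> u \<bullet> n = 0"

text \<open>Project the normal \<open>m\<close> of the other facet that contains the edge onto the plane of \<open>V\<close>.  On
  \<open>V\<close> the function \<open>n \<bullet> x\<close> is constant, so the projection still separates \<open>w\<close> from the edge.\<close>

lemma ridge_normal_exists:
  fixes V :: "(real^3) set"
  assumes ind: "\<not> affine_dependent (insert a V)" and a: "a \<notin> V" and card: "card V = 3" and w: "w \<in> V"
    and n: "inner_unit_normal (insert a V) a n b"
  shows "\<exists>u g. ridge_normal V w n u g"
proof -
  have fin: "finite V" by (rule card_ge_0_finite) (simp add: card)
  have "card (insert a V) = Suc DIM(real^3)" using a card fin by simp
  then obtain m d where m: "inner_unit_normal (insert a V) w m d"
    using inner_unit_normal_exists[OF ind] w by blast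
  have n1: "norm n = 1" and nV: "\<And>x. x \<in> V \<Longrightarrow> n \<bullet> x = b"
    using n a by (auto simp: inner_unit_normal_def)
  have mV: "\<And>x. x \<in> V - {w} \<Longrightarrow> m \<bullet> x = d" and mw: "d < m \<bullet> w"
    using m by (auto simp: inner_unit_normal_def)
  define u where "u = m - (m \<bullet> n) *\<^sub>R n"
  define g where "g = d - (m \<bullet> n) * b"
  have un: "u \<bullet> n = 0" using n1 by (simp add: u_def inner_diff_left dot_square_norm)
  have uV: "\<And>x. x \<in> V - {w} \<Longrightarrow> u \<bullet> x = g" using nV mV by (auto simp: u_def g_def inner_diff_left)
  have uw: "g < u \<bullet> w" using nV[OF w] mw by (auto simp: u_def g_def inner_diff_left)
  have "card (V - {w}) = 2" using card w fin by simp
  then have "V - {w} \<noteq> {}" by force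
  then obtain p where "p \<in> V - {w}" by blast
  then have u0: "u \<noteq> 0" using uV uw by fastforce
  have "ridge_normal V w n (u /\<^sub>R norm u) (g / norm u)"
    using un uV uw u0 by (auto simp: ridge_normal_def inner_unit_normal_def field_simps)
  then show ?thesis by blast
qed

lemma bessel_orthonormal_pair:
  fixes u n q :: "'a::real_inner"
  assumes "u \<bullet> u = 1" "n \<bullet> n = 1" "n \<bullet> u = 0"
  shows "(u \<bullet> q)\<^sup>2 + (n \<bullet> q)\<^sup>2 \<le> (norm q)\<^sup>2"
proof -
  define s where "s = u \<bullet> q"
  define H where "H = n \<bullet> q"
  have e: "u \<bullet> q = s" "q \<bullet> u = s" "n \<bullet> q = H" "q \<bullet> n = H" "u \<bullet> n = 0"
    using assms by (simp_all add: s_def H_def inner_commute)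
  have "0 \<le> (norm (q - s *\<^sub>R u - H *\<^sub>R n))\<^sup>2" by simp
  also have "\<dots> = (norm q)\<^sup>2 - s\<^sup>2 - H\<^sup>2"
    unfolding power2_norm_eq_inner
    by (simp add: inner_diff_left inner_diff_right e assms power2_eq_square)
  finally show ?thesis by (simp add: s_def H_def)
qed

text \<open>In the plane spanned by \<open>u\<close> and \<open>n\<close> the edge is a point, the two facets through it are rays,
  and the apex has coordinates \<open>(s, H)\<close> relative to that point.  Rotating the direction of the apex by
  a right angle yields the normal \<open>m\<close> of the second facet, and the distance of the incenter from the
  second facet, written in these coordinates, determines its \<open>u\<close>-coordinate.\<close>

lemma incenter_ridge_distance:
  fixes V :: "(real^3) set"
  assumes ind: "\<not> affine_dependent (insert a V)" and a: "a \<notin> V" and card: "card V = 3" and w: "w \<in> V"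
    and n: "inner_unit_normal (insert a V) a n b" and u: "ridge_normal V w n u g"
  defines "T \<equiv> convex hull (insert a V)"
  obtains H s L where "H > 0" "L > 0" "s\<^sup>2 + H\<^sup>2 = L\<^sup>2" "insphere_diameter T \<le> H" "L \<le> diameter T"
    "(u \<bullet> incenter T - g) * H = inradius T * (L + s)"
    "insphere_diameter T \<le> u \<bullet> w - g"
proof -
  have fin: "finite V" by (rule card_ge_0_finite) (simp add: card)
  have card4: "card (insert a V) = 4" using a card fin by simp
  have n1: "norm n = 1" and nV: "\<And>x. x \<in> V \<Longrightarrow> n \<bullet> x = b" and na: "b < n \<bullet> a"
    using n a by (auto simp: inner_unit_normal_def)
  have u1: "norm u = 1" and uV: "\<And>x. x \<in> V - {w} \<Longrightarrow> u \<bullet> x = g" and uw: "g < u \<bullet> w" and un: "u \<bullet> n = 0"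
    using u by (auto simp: inner_unit_normal_def ridge_normal_def)
  define H where "H = n \<bullet> a - b"
  define s where "s = u \<bullet> a - g"
  define L where "L = sqrt (s\<^sup>2 + H\<^sup>2)"
  have H: "H > 0" using na by (simp add: H_def)
  have sq: "s\<^sup>2 + H\<^sup>2 = L\<^sup>2" by (simp add: L_def)
  have L: "L > 0" using H by (simp add: L_def add_nonneg_pos)
  have HL: "H \<le> L" unfolding L_def by (rule real_le_rsqrt) simp
  have uu: "u \<bullet> u = 1" "n \<bullet> n = 1" "n \<bullet> u = 0" using u1 n1 un by (auto simp: dot_square_norm inner_commute)
  \<comment> \<open>The inner unit normal, with offset \<open>d\<close>, of the facet that contains the edge and the apex.\<close>
  define m where "m = (H / L) *\<^sub>R u - (s / L) *\<^sub>R n"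
  define d where "d = (H * g - s * b) / L"
  have mx: "m \<bullet> x - d = (H * (u \<bullet> x - g) - s * (n \<bullet> x - b)) / L" for x
    using L by (simp add: m_def d_def inner_diff_left field_simps)
  have "(norm m)\<^sup>2 = (H / L)\<^sup>2 + (s / L)\<^sup>2"
    unfolding power2_norm_eq_inner m_def using uu un
    by (simp add: inner_diff_left inner_diff_right power2_eq_square)
  also have "\<dots> = 1" using sq L by (simp add: power_divide add_divide_distrib[symmetric] add.commute)
  finally have m1: "norm m = 1" by (simp add: power2_eq_1_iff) (smt (verit) norm_ge_zero)
  have m: "inner_unit_normal (insert a V) w m d"
    unfolding inner_unit_normal_def
  proof (intro conjI ballI m1)
    fix x assume "x \<in> insert a V - {w}"
    then have "m \<bullet> x - d = 0" unfolding mx using uV nV by (auto simp: H_def s_def)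
    then show "m \<bullet> x = d" by simp
  next
    have "m \<bullet> w - d > 0" unfolding mx using uw nV[OF w] H L by simp
    then show "d < m \<bullet> w" by simp
  qed
  note sph = inscribed_sphere_of_tetrahedron[OF ind card4, folded T_def]
  note height = height_ge_insphere_diameter[OF ind card4, folded T_def]
  have nz: "n \<bullet> incenter T = b + inradius T" using sph(3)[OF _ n] by simp
  have "m \<bullet> incenter T = d + inradius T" using sph(3)[OF _ m] w by simp
  then have "(H * (u \<bullet> incenter T - g) - s * inradius T) / L = inradius T"
    using mx[of "incenter T"] nz by simp
  then have tan: "(u \<bullet> incenter T - g) * H = inradius T * (L + s)"
    using L by (simp add: field_simps)
  have dH: "insphere_diameter T \<le> H" using height[OF _ n] by (simp add: H_def)
  have "insphere_diameter T \<le> m \<bullet> w - d" using height[OF _ m] w by simp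
  \<comment> \<open>The altitude of \<open>T\<close> from \<open>w\<close> is at most the altitude of the face from \<open>w\<close>.\<close>
  also have "\<dots> = H / L * (u \<bullet> w - g)" using mx[of w] nV[OF w] by simp
  also have "\<dots> \<le> 1 * (u \<bullet> w - g)" using HL H L uw by (intro mult_right_mono) auto
  finally have dw: "insphere_diameter T \<le> u \<bullet> w - g" by simp
  have "card (V - {w}) = 2" using card w fin by simp
  then have "V - {w} \<noteq> {}" by force
  then obtain p where p: "p \<in> V - {w}" by blast
  have s: "s = u \<bullet> (a - p)" and Hp: "H = n \<bullet> (a - p)"
    using uV[OF p] nV[of p] p by (auto simp: s_def H_def inner_diff_right)
  have "s\<^sup>2 + H\<^sup>2 \<le> (norm (a - p))\<^sup>2"
    unfolding s Hp using uu by (intro bessel_orthonormal_pair)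
  then have "L\<^sup>2 \<le> (norm (a - p))\<^sup>2" unfolding sq .
  then have "L \<le> norm (a - p)" by (rule power2_le_imp_le) simp
  also have "\<dots> = dist a p" by (simp add: dist_norm)
  also have "\<dots> \<le> diameter T"
    unfolding T_def using p fin
    by (intro diameter_bounded_bound bounded_convex_hull finite_imp_bounded) (auto intro!: hull_inc)
  finally have Lh: "L \<le> diameter T" .
  show ?thesis using that H L sq dH Lh tan dw by blast
qed

text \<open>With \<open>sin \<alpha> = inverse c0\<close> this is the half-angle identity
  \<open>sqrt (-1 + 2 / (1 + cos \<alpha>)) = sin \<alpha> / (1 + cos \<alpha>) = tan (\<alpha>/2)\<close>.\<close>

lemma frak_c2_altdef:
  assumes "c0 \<ge> 1"
  shows "frak_c2 c0 = inverse (2 * c0) * (inverse c0 / (1 + sqrt (1 - inverse (c0\<^sup>2))))"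
proof -
  define k where "k = inverse c0"
  define C where "C = sqrt (1 - k\<^sup>2)"
  have k: "0 < k" "k \<le> 1" using \<open>c0 \<ge> 1\<close> by (simp_all add: k_def inverse_le_1_iff)
  then have "k\<^sup>2 \<le> 1" by (simp add: power_le_one)
  then have C: "C \<ge> 0" "C\<^sup>2 = 1 - k\<^sup>2" by (auto simp: C_def)
  have "(k / (1 + C))\<^sup>2 = (1 - C\<^sup>2) / (1 + C)\<^sup>2" using C by (simp add: power_divide)
  also have "\<dots> = -1 + 2 / (1 + C)"
    using C(1) by (simp add: divide_simps power2_eq_square) (simp add: algebra_simps)
  finally have "sqrt (-1 + 2 / (1 + C)) = sqrt ((k / (1 + C))\<^sup>2)" by simp
  also have "\<dots> = k / (1 + C)" using k C by (intro real_sqrt_unique) auto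
  finally show ?thesis by (simp add: frak_c2_def k_def C_def power_inverse)
qed

text \<open>With \<open>s = L cos \<theta>\<close> and \<open>H = L sin \<theta>\<close>, the quotient \<open>(L + s) / H\<close> is \<open>cot (\<theta>/2)\<close>, and the
  claim follows from \<open>sin \<theta> \<ge> inverse c0\<close> as \<open>cot (\<theta>/2) \<ge> tan (\<alpha>/2)\<close>.  Rewriting \<open>(L + s) / H\<close> as
  \<open>H / (L - s)\<close> bounds numerator and denominator separately, for acute and obtuse angles alike.\<close>

lemma frak_c2_lower_bound:
  fixes c0 H L s r h :: real
  assumes "0 < H" "0 < L" "s\<^sup>2 + H\<^sup>2 = L\<^sup>2" "2 * r \<le> H" "L \<le> h" "h \<le> c0 * (2 * r)" "c0 \<ge> 1"
  shows "frak_c2 c0 * h * H \<le> r * (L + s)"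
proof -
  define k where "k = inverse c0"
  define C where "C = sqrt (1 - k\<^sup>2)"
  have k: "0 < k" "k \<le> 1" using \<open>c0 \<ge> 1\<close> by (simp_all add: k_def inverse_le_1_iff)
  then have "k\<^sup>2 \<le> 1" by (simp add: power_le_one)
  then have C: "C \<ge> 0" "C\<^sup>2 = 1 - k\<^sup>2" by (auto simp: C_def)
  have kh: "k * h \<le> 2 * r" using assms by (simp add: k_def field_simps)
  have "k * L \<le> k * h" using assms k by simp
  \<comment> \<open>\<open>sin \<theta> \<ge> sin \<alpha>\<close>, and hence \<open>\<bar>cos \<theta>\<bar> \<le> cos \<alpha>\<close>.\<close>
  then have kL: "k * L \<le> H" using kh assms by simp
  have "\<bar>s\<bar> \<le> C * L"
  proof (rule power2_le_imp_le)
    have "(k * L)\<^sup>2 \<le> H\<^sup>2" using kL k assms by (intro power_mono) auto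
    moreover have "(C * L)\<^sup>2 = L\<^sup>2 - (k * L)\<^sup>2" unfolding power_mult_distrib C(2) by (simp add: algebra_simps)
    ultimately show "\<bar>s\<bar>\<^sup>2 \<le> (C * L)\<^sup>2" using assms(3) by simp
  qed (use C assms in auto)
  then have Ls: "L - s \<le> (1 + C) * L" by (simp add: algebra_simps)
  have "s\<^sup>2 < L\<^sup>2" using assms by (smt (verit) zero_less_power)
  then have sL: "\<bar>s\<bar> < L" using assms(2) by (metis abs_le_square_iff abs_of_pos not_less)
  have prod: "(L - s) * (L + s) = H * H" using assms(3) by (simp add: power2_eq_square algebra_simps)
  have half: "k / (1 + C) * H \<le> L + s"
  proof -
    have "k * H * (L - s) \<le> k * H * ((1 + C) * L)" using Ls k assms by (intro mult_left_mono) auto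
    also have "\<dots> = (1 + C) * H * (k * L)" by simp
    also have "\<dots> \<le> (1 + C) * H * H" using kL C assms by (intro mult_left_mono) auto
    also have "\<dots> = (1 + C) * (L + s) * (L - s)" using prod by (simp add: algebra_simps)
    finally have "k * H \<le> (1 + C) * (L + s)" using sL by (simp add: mult_le_cancel_right)
    then show ?thesis using C by (simp add: field_simps)
  qed
  have "0 < k * h" using k assms by simp
  then have r: "0 < r" using kh by linarith
  have "frak_c2 c0 * h * H = (k * h / 2) * (k / (1 + C) * H)"
    using assms by (simp add: frak_c2_altdef k_def C_def power_inverse)
  also have "\<dots> \<le> r * (L + s)"
    using kh half k C assms sL r by (intro mult_mono) auto
  finally show ?thesis .
qed

section \<open>Shape regularity\<close>

text \<open>The second bound makes the square roots in the constants meaningful: a tetrahedron has an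
  altitude that is at least the diameter of the inscribed sphere and at most the diameter of the
  tetrahedron.\<close>

lemma shape_regularity_bounds:
  assumes mesh: "tetrahedral_mesh \<T>" and T: "T \<in> \<T>"
  shows "diameter T \<le> shape_regularity \<T> * insphere_diameter T" "shape_regularity \<T> \<ge> 1"
proof -
  have fin: "finite \<T>" and sT: "3 simplex T"
    using mesh T unfolding tetrahedral_mesh_def triangulation_def by blast+
  obtain c where c: "\<not> affine_dependent c" "int (card c) = 3 + 1" "T = convex hull c"
    using sT unfolding simplex_def by blast
  then have card4: "card c = 4" by simp
  then have "c \<noteq> {}" by force
  then obtain a where a: "a \<in> c" by blast
  have finc: "finite c" using c(1) aff_independent_finite by blast
  have V: "insert a (c - {a}) = c" "a \<notin> c - {a}" "card (c - {a}) = 3" using a card4 finc by auto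
  then have "c - {a} \<noteq> {}" by force
  then obtain w where w: "w \<in> c - {a}" by blast
  obtain n b where n: "inner_unit_normal c a n b"
    using inner_unit_normal_exists[OF c(1) _ a] card4 by auto
  obtain u g where u: "ridge_normal (c - {a}) w n u g"
    using ridge_normal_exists[of a "c - {a}" w n b] V w n c(1) by auto
  obtain H s L where HL: "H > 0" "L > 0" "s\<^sup>2 + H\<^sup>2 = L\<^sup>2" "insphere_diameter T \<le> H" "L \<le> diameter T"
    using incenter_ridge_distance[of a "c - {a}" w n b u g] V w n u c by metis
  have "H\<^sup>2 \<le> L\<^sup>2" using HL(3) by (smt (verit) zero_le_power2)
  then have "H \<le> L" by (rule power2_le_imp_le) (use HL in simp)
  then have le: "insphere_diameter T \<le> diameter T" using HL by linarith
  have pos: "insphere_diameter T > 0"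
    using inscribed_sphere_of_tetrahedron(1)[OF c(1) card4] c(3) by (simp add: insphere_diameter_def)
  have "diameter T / insphere_diameter T \<le> shape_regularity \<T>"
    unfolding shape_regularity_def using fin T by (intro Max_ge) auto
  then show "diameter T \<le> shape_regularity \<T> * insphere_diameter T" using pos by (simp add: divide_le_eq)
  have "1 \<le> diameter T / insphere_diameter T" using le pos by simp
  then show "shape_regularity \<T> \<ge> 1" using \<open>_ \<le> shape_regularity \<T>\<close> by linarith
qed

lemma frak_c2_incenter_bound:
  fixes V :: "(real^3) set"
  assumes mesh: "tetrahedral_mesh \<T>" and T: "T \<in> \<T>" "T = convex hull (insert a V)"
    and ind: "\<not> affine_dependent (insert a V)" and a: "a \<notin> V" and card: "card V = 3" and w: "w \<in> V"
    and n: "inner_unit_normal (insert a V) a n b" and u: "ridge_normal V w n u g"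
  shows "frak_c2 (shape_regularity \<T>) * diameter T \<le> u \<bullet> incenter T - g"
proof -
  obtain H s L where H: "H > 0" "L > 0" "s\<^sup>2 + H\<^sup>2 = L\<^sup>2" "insphere_diameter T \<le> H" "L \<le> diameter T"
    "(u \<bullet> incenter T - g) * H = inradius T * (L + s)"
    using incenter_ridge_distance[OF ind a card w n u] unfolding T(2)[symmetric] by metis
  have "frak_c2 (shape_regularity \<T>) * diameter T * H \<le> inradius T * (L + s)"
    using frak_c2_lower_bound[OF H(1-3)] H(4,5) shape_regularity_bounds[OF mesh T(1)]
    by (simp add: insphere_diameter_def)
  then show ?thesis using H(1,6) by (metis mult_le_cancel_right_pos)
qed

text \<open>Each of the two terms in \<^const>\<open>const_c2\<close> serves one kind of face: the first gives the bound
  for the incenters next to an interior face, the second the bound for the altitudes of a boundary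
  face.\<close>

lemma const_c2_mult_Min_le:
  assumes mesh: "tetrahedral_mesh \<T>" and T: "T \<in> \<T>" "F facet_of T"
  defines "K \<equiv> const_c2 (shape_regularity \<T>) * Min (diameter ` {T \<in> \<T>. F facet_of T})"
  shows "K \<le> frak_c2 (shape_regularity \<T>) * diameter T" "K \<le> insphere_diameter T / 3"
proof -
  let ?c = "shape_regularity \<T>"
  note reg = shape_regularity_bounds[OF mesh T(1)]
  have fin: "finite \<T>" and sT: "3 simplex T"
    using mesh T unfolding tetrahedral_mesh_def triangulation_def by blast+
  have h: "0 \<le> diameter T" using sT by (simp add: diameter_ge_0 compact_simplex compact_imp_bounded)
  have "inverse (?c\<^sup>2) \<le> 1" using reg(2) by (simp add: inverse_le_1_iff)
  then have "0 \<le> frak_c2 ?c" using reg(2) by (simp add: frak_c2_altdef add_nonneg_nonneg)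
  then have c: "0 \<le> const_c2 ?c" using reg(2) by (simp add: const_c2_def)
  have "Min (diameter ` {T \<in> \<T>. F facet_of T}) \<le> diameter T" using fin T by (intro Min_le) auto
  then have K: "K \<le> const_c2 ?c * diameter T" unfolding K_def using c by (rule mult_left_mono)
  have "const_c2 ?c * diameter T \<le> frak_c2 ?c * diameter T"
    using h by (intro mult_right_mono) (auto simp: const_c2_def)
  then show "K \<le> frak_c2 ?c * diameter T" using K by linarith
  have "const_c2 ?c * diameter T \<le> inverse (3 * ?c) * diameter T"
    using h by (intro mult_right_mono) (auto simp: const_c2_def)
  also have "\<dots> \<le> insphere_diameter T / 3" using reg by (simp add: field_simps)
  finally show "K \<le> insphere_diameter T / 3" using K by linarith
qed

section \<open>Faces in a conforming mesh\<close>

text \<open>Taking the extreme points of \<open>F\<close> as vertices makes \<open>V\<close> depend on \<open>F\<close> alone, so that all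
  tetrahedra with the facet \<open>F\<close> are described over the same \<open>V\<close>.\<close>

lemma facet_of_tetrahedron_vertices:
  fixes T F :: "(real^3) set"
  assumes T: "3 simplex T" and F: "F facet_of T"
  defines "V \<equiv> {v. v extreme_point_of F}"
  obtains a where "a \<notin> V" "\<not> affine_dependent (insert a V)" "card V = 3"
    "F = convex hull V" "T = convex hull (insert a V)"
proof -
  obtain c where c: "\<not> affine_dependent c" "int (card c) = 3 + 1" "T = convex hull c"
    using T by (auto simp: simplex_def)
  have fin: "finite c" using c(1) aff_independent_finite by blast
  obtain a where a: "a \<in> c" "F = convex hull (c - {a})"
    using F c facet_of_convex_hull_affine_independent by blast
  have "\<not> affine_dependent (c - {a})" using c(1) affine_independent_Diff by blast
  then have V: "V = c - {a}"
    using a by (auto simp: V_def extreme_point_of_convex_hull_affine_independent)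
  have "insert a V = c" using V a by blast
  then show ?thesis using that[of a] c a V fin by auto
qed

text \<open>By conformity the intersection is a face of \<open>T\<close>.  It is a proper one and contains the facet
  \<open>F\<close>, so the dimensions leave no choice.\<close>

lemma facet_inter_of_triangulation:
  assumes tri: "triangulation \<T>" and T: "T \<in> \<T>" "T' \<in> \<T>" "T \<noteq> T'"
    and F: "F facet_of T" "F \<subseteq> T'" and dim: "aff_dim T = aff_dim T'"
  shows "T \<inter> T' = F"
proof -
  have "(T \<inter> T') face_of T" "(T' \<inter> T) face_of T'"
    using tri T unfolding triangulation_def by blast+
  then have f: "(T \<inter> T') face_of T" "(T \<inter> T') face_of T'" by (simp_all add: Int_commute)
  have conv: "convex T" "convex T'" using tri T convex_simplex unfolding triangulation_def by blast+
  have FT: "F face_of T" "aff_dim F = aff_dim T - 1" using F by (auto simp: facet_of_def)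
  have ne: "T \<inter> T' \<noteq> T"
  proof
    assume eq: "T \<inter> T' = T"
    then have "T = T'" using f(2) face_of_aff_dim_lt[OF conv(2)] dim by fastforce
    then show False using T by simp
  qed
  have "aff_dim (T \<inter> T') < aff_dim T" using face_of_aff_dim_lt[OF conv(1) f(1) ne] .
  moreover have "F face_of (T \<inter> T')"
    using face_of_subset[OF FT(1)] F(2) face_of_imp_subset[OF FT(1)] by blast
  ultimately show ?thesis
    using face_of_aff_dim_lt[of "T \<inter> T'" F] FT(2) conv by (smt (verit) convex_Int)
qed

text \<open>A tetrahedron that meets the relative interior of \<open>F\<close> has \<open>F\<close> as a facet.  If \<open>T\<close> is the only one,
  the mesh looks like \<open>T\<close> near the relative interior of \<open>F\<close>, where \<open>F\<close> lies on the frontier of \<open>T\<close>.\<close>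

lemma unique_facet_imp_boundary_face:
  assumes mesh: "tetrahedral_mesh \<T>" and uni: "\<exists>!T. T \<in> \<T> \<and> F facet_of T"
  shows "boundary_face \<T> F"
proof -
  obtain T where T: "T \<in> \<T>" "F facet_of T" using uni by blast
  have tri: "triangulation \<T>" and sx: "\<And>S. S \<in> \<T> \<Longrightarrow> 3 simplex S"
    using mesh unfolding tetrahedral_mesh_def by blast+
  have fin: "finite \<T>" using tri unfolding triangulation_def by blast
  have dim: "aff_dim S = 3" if "S \<in> \<T>" for S using sx[OF that] aff_dim_simplex by blast
  have cl: "closed S" if "S \<in> \<T>" for S using sx[OF that] compact_simplex compact_imp_closed by blast
  have FT: "F face_of T" using T(2) by (simp add: facet_of_def)
  have "F \<noteq> T" using T(2) by (auto simp: facet_of_def)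
  have cF: "convex F" using FT face_of_imp_convex by blast
  have conT: "convex T" using sx[OF T(1)] convex_simplex by blast
  have FsT: "F \<subseteq> T" using FT face_of_imp_subset by blast
  have away: "x \<notin> S" if x: "x \<in> rel_interior F" and S: "S \<in> \<T>" "S \<noteq> T" for x S
  proof
    assume "x \<in> S"
    have xF: "x \<in> F" using x rel_interior_subset by blast
    have "(T \<inter> S) face_of T" "(S \<inter> T) face_of S"
      using tri T S unfolding triangulation_def by blast+
    then have f: "(T \<inter> S) face_of T" "(T \<inter> S) face_of S" by (simp_all add: Int_commute)
    have "F \<subseteq> T \<inter> S"
      using subset_of_face_of[OF f(1) FsT] x xF \<open>x \<in> S\<close> FsT by blast
    then have "T \<inter> S = F"
      using facet_inter_of_triangulation[OF tri T(1) S(1) _ T(2)] S dim T by auto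
    then have "F facet_of S" using f(2) T dim S(1) by (auto simp: facet_of_def)
    then show False using uni T S by blast
  qed
  have "rel_interior F \<subseteq> frontier (\<Union>\<T>)"
  proof
    fix x assume x: "x \<in> rel_interior F"
    have xF: "x \<in> F" using x rel_interior_subset by blast
    have xn: "x \<notin> interior (\<Union>\<T>)"
    proof
      assume "x \<in> interior (\<Union>\<T>)"
      \<comment> \<open>Removing the other tetrahedra leaves a neighbourhood of \<open>x\<close> that lies in \<open>T\<close>.\<close>
      moreover have "open (interior (\<Union>\<T>) - \<Union>(\<T> - {T}))"
        using fin cl by (intro open_Diff open_interior closed_Union) auto
      moreover have "interior (\<Union>\<T>) - \<Union>(\<T> - {T}) \<subseteq> T" using interior_subset by blast
      ultimately have "x \<in> interior T" using away[OF x] by (intro interiorI) auto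
      then have "x \<in> rel_interior T" using interior_subset_rel_interior by blast
      then show False using face_of_disjoint_rel_interior[OF FT \<open>F \<noteq> T\<close>] xF by blast
    qed
    have "x \<in> closure (\<Union>\<T>)" using xF FsT T(1) closure_subset by blast
    then show "x \<in> frontier (\<Union>\<T>)" using xn by (simp add: frontier_def)
  qed
  then have "closure (rel_interior F) \<subseteq> frontier (\<Union>\<T>)" by (intro closure_minimal) auto
  then have "F \<subseteq> frontier (\<Union>\<T>)" using convex_closure_rel_interior[OF cF] closure_subset by blast
  then show ?thesis using uni by (simp add: boundary_face_def)
qed

text \<open>If both apexes were on the same side, moving from inside the common facet a little towards \<open>a2\<close>
  would give a point of both simplices outside the facet.\<close>

lemma apexes_on_opposite_sides:
  fixes V :: "'a::euclidean_space set"
  assumes ind1: "\<not> affine_dependent (insert a1 V)" and ind2: "\<not> affine_dependent (insert a2 V)"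
    and a: "a1 \<notin> V" "a2 \<notin> V" and card: "card V = DIM('a)"
    and n: "inner_unit_normal (insert a1 V) a1 n b"
    and int: "convex hull (insert a1 V) \<inter> convex hull (insert a2 V) = convex hull V"
  shows "inner_unit_normal (insert a2 V) a2 (- n) (- b)"
proof -
  have fin: "finite V" using aff_independent_finite[OF ind1] by simp
  have nV: "\<And>x. x \<in> V \<Longrightarrow> n \<bullet> x = b" and n1: "norm n = 1" and na: "b < n \<bullet> a1"
    using n a by (auto simp: inner_unit_normal_def)
  have "n \<bullet> a2 < b"
  proof (rule ccontr)
    assume "\<not> n \<bullet> a2 < b"
    then have ge: "b \<le> n \<bullet> a2" by simp
    have c1: "card (insert a1 V) = Suc DIM('a)" and c2: "card (insert a2 V) = Suc DIM('a)"
      using a card fin by auto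
    obtain n2 b2 where n2: "inner_unit_normal (insert a2 V) a2 n2 b2"
      using inner_unit_normal_exists[OF ind2 c2] by blast
    have n2V: "\<And>x. x \<in> V \<Longrightarrow> n2 \<bullet> x = b2" and n2a: "b2 < n2 \<bullet> a2"
      using n2 a by (auto simp: inner_unit_normal_def)
    have "a2 \<in> affine hull (insert a1 V)" using affine_independent_span_eq[OF ind1 c1] by simp
    then obtain u where u: "sum u (insert a1 V) = 1" "a2 = (\<Sum>w\<in>insert a1 V. u w *\<^sub>R w)"
      using affine_hull_finite[of "insert a1 V"] fin by auto
    have "0 \<le> u a1 * (n \<bullet> a1 - b)"
      using inner_unit_normal_affine_combination[OF n _ _ u(1)] fin u(2) ge by simp
    then have u0: "0 \<le> u a1" using na by (simp add: zero_le_mult_iff)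
    define M where "M = (\<Sum>v\<in>V. \<bar>u v\<bar>)"
    have M: "\<bar>u v\<bar> \<le> M" if "v \<in> V" for v
      unfolding M_def using that fin by (intro member_le_sum) auto
    have M0: "M \<ge> 0" by (simp add: M_def sum_nonneg)
    \<comment> \<open>The weights \<open>e * M\<close> on \<open>V\<close> and \<open>e\<close> on \<open>a2\<close> have sum \<open>1\<close>, and \<open>M\<close> is so large that replacing \<open>a2\<close> by its
        coordinates over \<open>insert a1 V\<close> keeps all weights nonnegative.\<close>
    define e where "e = 1 / (1 + card V * M)"
    have e: "e > 0" "e * (1 + card V * M) = 1" using M0 by (auto simp: e_def add_pos_nonneg add_nonneg_eq_0_iff)
    define x where "x = e *\<^sub>R (M *\<^sub>R (\<Sum>v\<in>V. v) + a2)"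
    define k1 where "k1 w = (if w = a1 then e * u a1 else e * (M + u w))" for w
    define k2 where "k2 w = (if w = a2 then e else e * M)" for w
    have k1V: "k1 w = e * (M + u w)" if "w \<in> V" for w using that a by (auto simp: k1_def)
    have k1a: "k1 a1 = e * u a1" and k2a: "k2 a2 = e" by (simp_all add: k1_def k2_def)
    have V1: "(\<Sum>w\<in>V. k1 w) = (\<Sum>w\<in>V. e * (M + u w))"
      "(\<Sum>w\<in>V. k1 w *\<^sub>R w) = (\<Sum>w\<in>V. (e * (M + u w)) *\<^sub>R w)"
      by (rule sum.cong; simp add: k1V)+
    have k2V: "k2 w = e * M" if "w \<in> V" for w using that a by (auto simp: k2_def)
    have V2: "(\<Sum>w\<in>V. k2 w) = (\<Sum>w\<in>V. e * M)"
      "(\<Sum>w\<in>V. k2 w *\<^sub>R w) = (\<Sum>w\<in>V. (e * M) *\<^sub>R w)"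
      by (rule sum.cong; simp add: k2V)+
    have s1: "sum k1 (insert a1 V) = 1"
    proof -
      have "sum k1 (insert a1 V) = e * (card V * M + sum u (insert a1 V))"
        using a fin by (simp add: V1 k1a sum.distrib algebra_simps sum_distrib_left)
      then show ?thesis using u(1) e(2) by (simp add: algebra_simps)
    qed
    have x1: "(\<Sum>w\<in>insert a1 V. k1 w *\<^sub>R w) = x"
      unfolding x_def u(2) using a fin
      by (simp add: V1 k1a scaleR_add_left scaleR_add_right sum.distrib scaleR_sum_right algebra_simps)
    have s2: "sum k2 (insert a2 V) = 1"
      using a fin e(2) by (simp add: V2 k2a algebra_simps)
    have x2: "(\<Sum>w\<in>insert a2 V. k2 w *\<^sub>R w) = x"
      unfolding x_def using a fin
      by (simp add: V2 k2a scaleR_add_right scaleR_sum_right)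
    have "\<forall>w\<in>insert a1 V. 0 \<le> k1 w" using e u0 M by (force simp: k1_def)
    then have "x \<in> convex hull (insert a1 V)" using s1 x1 fin by (auto simp: convex_hull_finite)
    moreover have "\<forall>w\<in>insert a2 V. 0 \<le> k2 w" using e M0 by (auto simp: k2_def)
    then have "x \<in> convex hull (insert a2 V)" using s2 x2 fin by (auto simp: convex_hull_finite)
    ultimately have "x \<in> convex hull V" using int by blast
    moreover have "convex hull V \<subseteq> {y. n2 \<bullet> y = b2}"
      using n2V by (intro hull_minimal convex_hyperplane) auto
    ultimately have "n2 \<bullet> x - b2 = 0" by auto
    moreover have "n2 \<bullet> x - b2 = k2 a2 * (n2 \<bullet> a2 - b2)"
      using inner_unit_normal_affine_combination[OF n2 _ _ s2] fin x2 by simp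
    ultimately show False using e n2a by (simp add: k2_def)
  qed
  then show ?thesis using nV n1 a by (auto simp: inner_unit_normal_def)
qed

text \<open>Among the apexes of three tetrahedra over \<open>F\<close>, two would be on the same side.\<close>

lemma two_facet_neighbours:
  fixes \<T> :: "(real^3) set set"
  assumes mesh: "tetrahedral_mesh \<T>"
    and T: "T1 \<in> \<T>" "T2 \<in> \<T>" "T3 \<in> \<T>" "T1 \<noteq> T2" "T1 \<noteq> T3"
    and F: "F facet_of T1" "F facet_of T2" "F facet_of T3"
  shows "T2 = T3"
proof (rule ccontr)
  assume ne: "T2 \<noteq> T3"
  have tri: "triangulation \<T>" and sx: "\<And>S. S \<in> \<T> \<Longrightarrow> 3 simplex S"
    using mesh unfolding tetrahedral_mesh_def by blast+
  have dim: "aff_dim S = 3" if "S \<in> \<T>" for S using sx[OF that] aff_dim_simplex by blast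
  define V where "V = {v. v extreme_point_of F}"
  have int: "S \<inter> S' = F" if "S \<in> \<T>" "S' \<in> \<T>" "S \<noteq> S'" "F facet_of S" "F facet_of S'" for S S'
    using facet_inter_of_triangulation[OF tri that(1-4)] that dim facet_of_imp_subset by metis
  obtain a1 where 1: "a1 \<notin> V" "\<not> affine_dependent (insert a1 V)" "card V = 3" "F = convex hull V" "T1 = convex hull (insert a1 V)"
    using facet_of_tetrahedron_vertices[OF sx[OF T(1)] F(1)] unfolding V_def by metis
  obtain a2 where 2: "a2 \<notin> V" "\<not> affine_dependent (insert a2 V)" "T2 = convex hull (insert a2 V)"
    using facet_of_tetrahedron_vertices[OF sx[OF T(2)] F(2)] unfolding V_def by metis
  obtain a3 where 3: "a3 \<notin> V" "\<not> affine_dependent (insert a3 V)" "T3 = convex hull (insert a3 V)"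
    using facet_of_tetrahedron_vertices[OF sx[OF T(3)] F(3)] unfolding V_def by metis
  have fin: "finite V" by (rule card_ge_0_finite) (simp add: 1)
  have D: "card V = DIM(real^3)" using 1 by simp
  have D1: "card (insert a1 V) = Suc DIM(real^3)" using 1 fin by simp
  obtain n b where n1: "inner_unit_normal (insert a1 V) a1 n b"
    using inner_unit_normal_exists[OF 1(2) D1] by blast
  have n2: "inner_unit_normal (insert a2 V) a2 (- n) (- b)"
    using apexes_on_opposite_sides[OF 1(2) 2(2) 1(1) 2(1) D n1] int[of T1 T2] T F 1 2 by simp
  have n3: "inner_unit_normal (insert a3 V) a3 (- n) (- b)"
    using apexes_on_opposite_sides[OF 1(2) 3(2) 1(1) 3(1) D n1] int[of T1 T3] T F 1 3 by simp
  have "inner_unit_normal (insert a3 V) a3 (- (- n)) (- (- b))"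
    using apexes_on_opposite_sides[OF 2(2) 3(2) 2(1) 3(1) D n2] int[of T2 T3] T F 1 2 3 ne by simp
  then show False using n3 by (simp add: inner_unit_normal_def)
qed

section \<open>Distance of the split point from the edges\<close>

text \<open>The segment crosses the plane of the facet at the point that divides it in the ratio of the
  inradii.  This point is the same convex combination of the two touching points, which belong to
  the facet.\<close>

lemma incenter_segment_meets_facet:
  fixes V :: "(real^3) set"
  assumes ind1: "\<not> affine_dependent (insert a1 V)" and ind2: "\<not> affine_dependent (insert a2 V)"
    and a: "a1 \<notin> V" "a2 \<notin> V" and card: "card V = 3"
    and n: "inner_unit_normal (insert a1 V) a1 n b" "inner_unit_normal (insert a2 V) a2 (- n) (- b)"
  defines "T1 \<equiv> convex hull (insert a1 V)" and "T2 \<equiv> convex hull (insert a2 V)"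
  obtains t where "0 < t" "t < 1"
    "convex hull V \<inter> closed_segment (incenter T1) (incenter T2) = {(1 - t) *\<^sub>R incenter T1 + t *\<^sub>R incenter T2}"
proof -
  define z1 where "z1 = incenter T1"
  define z2 where "z2 = incenter T2"
  define r1 where "r1 = inradius T1"
  define r2 where "r2 = inradius T2"
  have fin: "finite V" by (rule card_ge_0_finite) (simp add: card)
  have card4: "card (insert a1 V) = 4" "card (insert a2 V) = 4" using a card fin by auto
  note sph1 = inscribed_sphere_of_tetrahedron[OF ind1 card4(1), folded T1_def]
  note sph2 = inscribed_sphere_of_tetrahedron[OF ind2 card4(2), folded T2_def]
  have r: "r1 > 0" "r2 > 0" using sph1(1) sph2(1) by (auto simp: r1_def r2_def)
  have z: "n \<bullet> z1 = b + r1" "n \<bullet> z2 = b - r2"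
    using sph1(3)[OF _ n(1)] sph2(3)[OF _ n(2)] by (auto simp: z1_def z2_def r1_def r2_def)
  define t where "t = r1 / (r1 + r2)"
  have t: "0 < t" "t < 1" "1 - t = r2 / (r1 + r2)" using r by (auto simp: t_def field_simps)
  define m where "m = (1 - t) *\<^sub>R z1 + t *\<^sub>R z2"
  have p1: "z1 - r1 *\<^sub>R n \<in> convex hull V"
    using touching_point_in_facet[OF ind1 a(1) card n(1)] by (simp add: z1_def r1_def T1_def)
  have p2: "z2 + r2 *\<^sub>R n \<in> convex hull V"
    using touching_point_in_facet[OF ind2 a(2) card n(2)] by (simp add: z2_def r2_def T2_def)
  have "(1 - t) * r1 = t * r2" unfolding t(3) by (simp add: t_def)
  then have "m = (1 - t) *\<^sub>R (z1 - r1 *\<^sub>R n) + t *\<^sub>R (z2 + r2 *\<^sub>R n)"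
    by (simp add: m_def scaleR_diff_right scaleR_add_right)
  then have mV: "m \<in> convex hull V"
    using convexD[OF convex_convex_hull p1 p2, of "1 - t" t] t by simp
  have mS: "m \<in> closed_segment z1 z2" using t by (auto simp: in_segment m_def intro!: exI[of _ t])
  have "y = m" if y: "y \<in> convex hull V" "y \<in> closed_segment z1 z2" for y
  proof -
    obtain s where s: "y = (1 - s) *\<^sub>R z1 + s *\<^sub>R z2" using y(2) by (auto simp: in_segment)
    have "convex hull V \<subseteq> {y. n \<bullet> y = b}"
      using n(1) a by (intro hull_minimal convex_hyperplane) (auto simp: inner_unit_normal_def)
    then have "n \<bullet> y = b" using y by auto
    then have "(1 - s) * (b + r1) + s * (b - r2) = b" using s z by (simp add: inner_add_right)
    then have "s * (r1 + r2) = r1" by (simp add: algebra_simps)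
    then have "s = t" using r by (simp add: t_def field_simps)
    then show ?thesis using s by (simp add: m_def)
  qed
  then have "convex hull V \<inter> closed_segment z1 z2 = {m}" using mV mS by blast
  then show ?thesis using that[OF t(1,2)] unfolding m_def z1_def z2_def by blast
qed

text \<open>The relative frontier consists of the simplices spanned by \<open>V - {w}\<close>.  A unit vector \<open>u\<close>
  that is constant on such a simplex bounds the distance to it from below by Cauchy-Schwarz.\<close>

lemma infdist_rel_frontier_simplex_ge:
  fixes V :: "'a::euclidean_space set"
  assumes ind: "\<not> affine_dependent V" and card: "card V \<ge> 2"
    and far: "\<And>w. w \<in> V \<Longrightarrow> \<exists>u g. norm u = 1 \<and> (\<forall>x\<in>V - {w}. u \<bullet> x = g) \<and> K \<le> u \<bullet> m - g"
  shows "K \<le> infdist m (rel_frontier (convex hull V))"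
proof -
  have fin: "finite V" using ind aff_independent_finite by blast
  have "closed (convex hull V)" using fin by (simp add: compact_imp_closed finite_imp_compact_convex_hull)
  then have rf: "rel_frontier (convex hull V) = (\<Union>w\<in>V. convex hull (V - {w}))"
    using rel_boundary_of_convex_hull[OF ind] by (simp add: rel_frontier_def)
  have "K \<le> dist m y" if y: "y \<in> rel_frontier (convex hull V)" for y
  proof -
    obtain w where w: "w \<in> V" "y \<in> convex hull (V - {w})" using y unfolding rf by blast
    obtain u g where u: "norm u = 1" "\<forall>x\<in>V - {w}. u \<bullet> x = g" "K \<le> u \<bullet> m - g" using far[OF w(1)] by blast
    have "convex hull (V - {w}) \<subseteq> {x. u \<bullet> x = g}"
      using u(2) by (intro hull_minimal convex_hyperplane) auto
    then have "u \<bullet> y = g" using w by blast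
    then have "K \<le> u \<bullet> (m - y)" using u(3) by (simp add: inner_diff_right)
    also have "\<dots> \<le> norm u * norm (m - y)" by (rule norm_cauchy_schwarz)
    finally show ?thesis using u(1) by (simp add: dist_norm)
  qed
  moreover have "rel_frontier (convex hull V) \<noteq> {}"
  proof -
    obtain w where w: "w \<in> V" using card by fastforce
    have "card (V - {w}) \<ge> 1" using card w fin by simp
    then have "V - {w} \<noteq> {}" by force
    then show ?thesis unfolding rf using w by auto
  qed
  ultimately show ?thesis by (auto simp: infdist_notempty intro!: cINF_greatest)
qed

theorem lemma3p3:
  fixes \<T> :: "(real^3) set set" and F :: "(real^3) set"
  assumes "tetrahedral_mesh \<T>"
    and "F \<in> mesh_faces \<T>"
  shows "infdist (split_point \<T> F) (rel_frontier F)
           \<ge> const_c2 (shape_regularity \<T>) * Min (diameter ` {T \<in> \<T>. F facet_of T})"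
proof -
  note mesh = assms(1)
  define K where "K = const_c2 (shape_regularity \<T>) * Min (diameter ` {T \<in> \<T>. F facet_of T})"
  define V where "V = {v. v extreme_point_of F}"
  have tri: "triangulation \<T>" and sx: "\<And>S. S \<in> \<T> \<Longrightarrow> 3 simplex S"
    using mesh unfolding tetrahedral_mesh_def by blast+
  have dim: "aff_dim S = 3" if "S \<in> \<T>" for S using sx[OF that] aff_dim_simplex by blast
  obtain T1 where T1: "T1 \<in> \<T>" "F facet_of T1" using assms(2) by (auto simp: mesh_faces_def)
  obtain a1 where a1: "a1 \<notin> V" "\<not> affine_dependent (insert a1 V)" "card V = 3" "F = convex hull V" "T1 = convex hull (insert a1 V)"
    using facet_of_tetrahedron_vertices[OF sx[OF T1(1)] T1(2)] unfolding V_def by metis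
  have fin: "finite V" by (rule card_ge_0_finite) (simp add: a1)
  have D1: "card (insert a1 V) = Suc DIM(real^3)" using a1 fin by simp
  have indV: "\<not> affine_dependent V" using a1(2) affine_independent_subset by blast
  obtain n b where n1: "inner_unit_normal (insert a1 V) a1 n b"
    using inner_unit_normal_exists[OF a1(2) D1] by blast
  have "\<exists>u g. norm u = 1 \<and> (\<forall>x\<in>V - {w}. u \<bullet> x = g) \<and> K \<le> u \<bullet> split_point \<T> F - g"
    if w: "w \<in> V" for w
  proof -
    obtain u g where u: "ridge_normal V w n u g" using ridge_normal_exists[OF a1(2,1,3) w n1] by blast
    have u1: "norm u = 1" and uV: "\<forall>x\<in>V - {w}. u \<bullet> x = g" and un: "u \<bullet> n = 0"
      using u by (auto simp: ridge_normal_def inner_unit_normal_def)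
    have "K \<le> u \<bullet> split_point \<T> F - g"
    proof (cases "boundary_face \<T> F")
      case True
      have "split_point \<T> F = (1 / 3) *\<^sub>R (\<Sum>v\<in>V. v)"
        using True a1(3) by (simp add: split_point_def barycenter_def V_def)
      moreover have "(\<Sum>v\<in>V. (1 / 3) *\<^sub>R v) = (1 / 3) *\<^sub>R (\<Sum>v\<in>V. v)" by (simp add: scaleR_sum_right)
      ultimately have "u \<bullet> split_point \<T> F - g = 1 / 3 * (u \<bullet> w - g)"
        using inner_unit_normal_affine_combination[of V w u g "\<lambda>_. 1 / 3"] u fin w a1(3)
        by (simp add: ridge_normal_def)
      moreover have "insphere_diameter T1 \<le> u \<bullet> w - g"
        using incenter_ridge_distance[OF a1(2,1,3) w n1 u] unfolding a1(5)[symmetric] by metis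
      moreover have "K \<le> insphere_diameter T1 / 3"
        using const_c2_mult_Min_le[OF mesh T1] by (simp add: K_def)
      ultimately show ?thesis by simp
    next
      case False
      then obtain T2 where T2: "T2 \<in> \<T>" "F facet_of T2" "T1 \<noteq> T2"
        using unique_facet_imp_boundary_face[OF mesh] T1 by metis
      have int: "T1 \<inter> T2 = F"
        using facet_inter_of_triangulation[OF tri T1(1) T2(1,3) T1(2)] T1 T2 dim facet_of_imp_subset by metis
      obtain a2 where a2: "a2 \<notin> V" "\<not> affine_dependent (insert a2 V)" "T2 = convex hull (insert a2 V)"
        using facet_of_tetrahedron_vertices[OF sx[OF T2(1)] T2(2)] unfolding V_def by metis
      have n2: "inner_unit_normal (insert a2 V) a2 (- n) (- b)"
        using apexes_on_opposite_sides[OF a1(2) a2(2) a1(1) a2(1) _ n1] int a1 a2 by simp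
      obtain t where t: "0 < t" "t < 1"
        and m: "F \<inter> closed_segment (incenter T1) (incenter T2) = {(1 - t) *\<^sub>R incenter T1 + t *\<^sub>R incenter T2}"
        using incenter_segment_meets_facet[OF a1(2) a2(2) a1(1) a2(1) a1(3) n1 n2] unfolding a1(4,5) a2(3) by metis
      have "(THE m. \<exists>T1\<in>\<T>. \<exists>T2\<in>\<T>. T1 \<noteq> T2 \<and> F = T1 \<inter> T2 \<and>
                     F \<inter> closed_segment (incenter T1) (incenter T2) = {m})
            = (1 - t) *\<^sub>R incenter T1 + t *\<^sub>R incenter T2"
      proof (rule the_equality)
        show "\<exists>T1'\<in>\<T>. \<exists>T2'\<in>\<T>. T1' \<noteq> T2' \<and> F = T1' \<inter> T2' \<and>
           F \<inter> closed_segment (incenter T1') (incenter T2') = {(1 - t) *\<^sub>R incenter T1 + t *\<^sub>R incenter T2}"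
          using T1 T2 int m by blast
      next
        fix m' assume "\<exists>T1\<in>\<T>. \<exists>T2\<in>\<T>. T1 \<noteq> T2 \<and> F = T1 \<inter> T2 \<and>
                     F \<inter> closed_segment (incenter T1) (incenter T2) = {m'}"
        then obtain S1 S2 where S: "S1 \<in> \<T>" "S2 \<in> \<T>" "S1 \<noteq> S2" "F = S1 \<inter> S2"
          and m': "F \<inter> closed_segment (incenter S1) (incenter S2) = {m'}" by blast
        have face: "(S1 \<inter> S2) face_of S1" "(S2 \<inter> S1) face_of S2"
          using tri S unfolding triangulation_def by blast+
        have "F facet_of S1" "F facet_of S2"
          using face S T1 dim by (auto simp: facet_of_def Int_commute)
        \<comment> \<open>Any admissible pair of tetrahedra is the given one up to order, and the order leaves the
            segment unchanged.\<close>
        then have "S1 = T1 \<and> S2 = T2 \<or> S1 = T2 \<and> S2 = T1"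
          using two_facet_neighbours[OF mesh] T1 T2 S by metis
        then show "m' = (1 - t) *\<^sub>R incenter T1 + t *\<^sub>R incenter T2"
          using m m' by (auto simp: closed_segment_commute)
      qed
      then have sp: "split_point \<T> F = (1 - t) *\<^sub>R incenter T1 + t *\<^sub>R incenter T2"
        using False by (simp add: split_point_def)
      have u': "ridge_normal V w (- n) u g" using u by (simp add: ridge_normal_def)
      have k1: "K \<le> u \<bullet> incenter T1 - g"
        using const_c2_mult_Min_le(1)[OF mesh T1] frak_c2_incenter_bound[OF mesh T1(1) a1(5,2,1,3) w n1 u]
        by (simp add: K_def)
      have k2: "K \<le> u \<bullet> incenter T2 - g"
        using const_c2_mult_Min_le(1)[OF mesh T2(1,2)] frak_c2_incenter_bound[OF mesh T2(1) a2(3,2,1) a1(3) w n2 u']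
        by (simp add: K_def)
      have "K = (1 - t) * K + t * K" by (simp add: algebra_simps)
      also have "\<dots> \<le> (1 - t) * (u \<bullet> incenter T1 - g) + t * (u \<bullet> incenter T2 - g)"
        using k1 k2 t by (intro add_mono mult_left_mono) auto
      also have "\<dots> = u \<bullet> split_point \<T> F - g"
        unfolding sp by (simp add: inner_add_right algebra_simps)
      finally show ?thesis .
    qed
    then show ?thesis using u1 uV by blast
  qed
  then have "K \<le> infdist (split_point \<T> F) (rel_frontier (convex hull V))"
    using a1(3) by (intro infdist_rel_frontier_simplex_ge[OF indV]) auto
  then show ?thesis using a1(4) by (simp add: K_def)
qed

end
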